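(* For every admissible input $(\{g_1,\dots,g_m\},f)$, i.e. $\{g_1,\dots,g_m\}$ a Gröbner basis (with respect to $\prec$) of the ideal $I_0=(g_1,\dots,g_m)$ of $P$ with $g_i\notin k$ for all $i$, and $f\in P$ with $f\neq 0$, the algorithm SimpleSignatureGroebner$(\{g_1,\dots,g_m\},f)$ terminates.
   Context: **Setting.** Let $k$ be a field, $P=k[x_1,\dots,x_n]$, $\mathbb{T}$ the monoid of monomials of $P$ with a monomial order $\prec$ (a well-order compatible with multiplication). Put $\mathbb{T}_0=\mathbb{T}\cup\{0\}$ (with $0\cdot t=0$), and extend $\prec$ to $\prec_0$ on $\mathbb{T}_0$ by $0\prec_0 t$ for all $t\in\mathbb{T}$. For $t_1,t_2\in\mathbb{T}_0$, $t_1\mid t_2$ means $t_1t_3=t_2$ for some $t_3\in\mathbb{T}$. For $p\in P\setminus\{0\}$, $\mathrm{HM}(p)\in\mathbb{T}$ and $\mathrm{HC}(p)\in k$ are the highest monomial and its coefficient with respect to $\prec$; $\mathrm{HM}(0)=0\in\mathbb{T}_0$, $\mathrm{HC}(0)=0\in k$. $\mathrm{LCM}$ is the least common multiple in $\mathbb{T}$. Fixed input: $\{g_1,\dots,g_m\}\subset P$ is a Gröbner basis of $I_0=(g_1,\dots,g_m)$, no $g_i$ lies in $k$, and $f\in P$, $f\neq 0$. **Labeled polynomials.** A labeled polynomial is a pair $h=(\sigma,p)\in\mathbb{T}_0\times P$ such that there is $u\in P$ with $\mathrm{HM}(u)=\sigma$ and $uf\equiv p\pmod{I_0}$. $H$ is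 the set of all labeled polynomials. Write $\mathrm{HM}(h)=\mathrm{HM}(p)$, $\mathrm{HC}(h)=\mathrm{HC}(p)$, signature $\mathcal{S}(h)=\sigma$, $\mathrm{poly}(h)=p$; for $t\in\mathbb{T}$, $th=(t\sigma,tp)$. **Signature-safe reduction.** If $h_1',h_2\in H$, $t\in\mathbb{T}$ satisfy $\mathcal{S}(h_1')\succ_0\mathcal{S}(th_2)$ and $\mathrm{HM}(h_1')=\mathrm{HM}(th_2)\neq0$, the signature-safe reduction of $h_1'$ by $h_2$ is $h_1=(\mathcal{S}(h_1'),\mathrm{poly}(h_1')+Kt\,\mathrm{poly}(h_2))$, with $K\in k$ chosen so that the highest terms cancel, i.e. $\mathrm{HM}(h_1)\prec_0\mathrm{HM}(h_1')$. **Order.** For $h_1=(\sigma_1,p_1)$, $h_2=(\sigma_2,p_2)$ in $H$: $h_1<_{\mathrm H}h_2$ (equivalently $h_2>_{\mathrm H}h_1$) iff $\mathrm{HM}(p_1)\sigma_2\prec_0\mathrm{HM}(p_2)\sigma_1$. This is a (strict) partial order. **Algorithm SimpleSignatureGroebner$(\{g_1,\dots,g_m\},f)$** (any choice is allowed where several are possible): 1. $R\leftarrow\{(\mathrm{HM}(g_1),0),\dots,(\mathrm{HM}(g_m),0),(0,g_1),\dots,(0,g_m)\}$. 2. $B\leftarrow\varnothing$. 3. $(\sigma,p')\leftarrow(1,f)$. 4. Do forever: (a) $p\leftarrow$ ReduceCheckingSignatures$(\sigma,p',R)$. (b) $R\leftarrow R\cup\{(\sigma,p)\}$. (c) If $p\neq0$: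 for every $r\in R$ with $r<_{\mathrm H}(\sigma,p)$ and $\mathrm{HM}(r)\neq0$, add $\frac{\mathrm{LCM}(\mathrm{HM}(r),\mathrm{HM}(p))}{\mathrm{HM}(r)}\,r$ to $B$; then for every $r\in R$ with $r>_{\mathrm H}(\sigma,p)$, add $\frac{\mathrm{LCM}(\mathrm{HM}(r),\mathrm{HM}(p))}{\mathrm{HM}(p)}(\sigma,p)$ to $B$. (d) $B\leftarrow B\setminus\{b\in B\mid\exists r\in R:\ r<_{\mathrm H}b\text{ and }\mathcal{S}(r)\mid\mathcal{S}(b)\}$. (e) If $B\neq\varnothing$: $(\sigma,p')\leftarrow$ an element of $B$ with $\prec$-minimal signature. (f) Else: break. 5. Return $\{\mathrm{poly}(r)\mid r\in R\}$. **ReduceCheckingSignatures$(\sigma,p,R)$:** while there is $r\in R$ with $r>_{\mathrm H}(\sigma,p)$ and $\mathrm{HM}(r)\mid\mathrm{HM}(p)$, replace $p$ by the polynomial of the signature-safe reduction of $(\sigma,p)$ by a $>_{\mathrm H}$-maximal such $r$; then return $p$. *)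

theory Defs
  imports Complex_Main "HOL-Library.Poly_Mapping"
begin

text \<open>
  A monomial is its exponent vector, so the monoid of monomials is written additively: the
  product of monomials is \<open>+\<close>, the monomial \<open>1\<close> is \<open>0\<close>, and \<open>-\<close> is the quotient whenever the
  division is exact. In \<open>('n, 'k) mpoly\<close> multiplication is the convolution product, so this is
  the polynomial ring over \<open>'k\<close> in the variables \<open>'n\<close>.
\<close>

type_synonym 'n mon = "'n \<Rightarrow>\<^sub>0 nat"
type_synonym ('n, 'k) mpoly = "'n mon \<Rightarrow>\<^sub>0 'k"

text \<open>The monomials with an extra element \<open>0\<close>, which is \<open>None\<close>.\<close>

type_synonym 'n mon0 = "'n mon option"

text \<open>Pairs of a signature and a polynomial.\<close>

type_synonym ('n, 'k) sigpoly = "'n mon0 \<times> ('n, 'k) mpoly"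

lift_definition lcm_mon :: "'n mon \<Rightarrow> 'n mon \<Rightarrow> 'n mon"
  is "\<lambda>s t i. max (s i) (t i)"
proof -
  fix s t :: "'n \<Rightarrow> nat"
  assume "finite {i. s i \<noteq> 0}" and "finite {i. t i \<noteq> 0}"
  then have "finite ({i. s i \<noteq> 0} \<union> {i. t i \<noteq> 0})" by simp
  then show "finite {i. max (s i) (t i) \<noteq> 0}"
    by (rule rev_finite_subset) (auto simp: max_def split: if_splits)
qed

fun mult0 :: "'n mon0 \<Rightarrow> 'n mon0 \<Rightarrow> 'n mon0" where
  "mult0 (Some s) (Some t) = Some (s + t)"
| "mult0 _ _ = None"

text \<open>The cofactor has to be a monomial, so \<open>None\<close> divides only itself and is not divisible by
  any \<open>Some s\<close>.\<close>

definition dvd0 :: "'n mon0 \<Rightarrow> 'n mon0 \<Rightarrow> bool" where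
  "dvd0 s t \<longleftrightarrow> (\<exists>u. mult0 s (Some u) = t)"

definition constants :: "('n, 'k::zero) mpoly set" where
  "constants = {Poly_Mapping.single 0 c | c. True}"

lemma module_mult: "module ((*) :: 'a \<Rightarrow> 'a \<Rightarrow> 'a::comm_ring_1)"
  by unfold_locales (auto simp: algebra_simps)

definition gen_ideal :: "'a::comm_ring_1 set \<Rightarrow> 'a set" where
  "gen_ideal A = module.span (*) A"

definition mon_times :: "'n mon \<Rightarrow> ('n, 'k::field) sigpoly \<Rightarrow> ('n, 'k) sigpoly" where
  "mon_times t h = (mult0 (Some t) (fst h), Poly_Mapping.single t 1 * snd h)"

text \<open>
  Configurations of a run: \<open>Reducing \<sigma> p R B\<close> means that the reduction procedure is being
  executed with current polynomial \<open>p\<close> of signature \<open>\<sigma>\<close>, in an iteration of the main loop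
  entered with the sets \<open>R\<close> and \<open>B\<close>; \<open>Returned S\<close> means that the algorithm has returned \<open>S\<close>.
\<close>

datatype ('s, 'p) config = Reducing 's 'p "('s \<times> 'p) set" "('s \<times> 'p) set" | Returned "'p set"

type_synonym ('n, 'k) gb_config = "('n mon0, ('n, 'k) mpoly) config"

locale monomial_order =
  fixes lt :: "'n::finite mon \<Rightarrow> 'n mon \<Rightarrow> bool"  (infix "\<prec>" 50)
  assumes transitive: "transp (\<prec>)"
    and linear: "totalp (\<prec>)"
    and well_founded: "wfp (\<prec>)"
    and compatible: "\<And>s t u. s \<prec> t \<Longrightarrow> u + s \<prec> u + t"
begin

fun less0 :: "'n mon0 \<Rightarrow> 'n mon0 \<Rightarrow> bool"  (infix "\<prec>\<^sub>0" 50) where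
  "None \<prec>\<^sub>0 Some _ \<longleftrightarrow> True"
| "Some s \<prec>\<^sub>0 Some t \<longleftrightarrow> s \<prec> t"
| "_ \<prec>\<^sub>0 None \<longleftrightarrow> False"

definition HM :: "('n, 'k::field) mpoly \<Rightarrow> 'n mon0" where
  "HM p = (if p = 0 then None
    else Some (THE t. t \<in> Poly_Mapping.keys p \<and> (\<forall>s \<in> Poly_Mapping.keys p. s \<noteq> t \<longrightarrow> s \<prec> t)))"

definition groebner_basis :: "('n, 'k::field) mpoly set \<Rightarrow> bool" where
  "groebner_basis G \<longleftrightarrow> (\<forall>p \<in> gen_ideal G. p \<noteq> 0 \<longrightarrow> (\<exists>g \<in> G. dvd0 (HM g) (HM p)))"

definition labeled :: "('n, 'k::field) mpoly set \<Rightarrow> ('n, 'k) mpoly \<Rightarrow> ('n, 'k) sigpoly set" where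
  "labeled G f = {(\<sigma>, p). \<exists>u. HM u = \<sigma> \<and> u * f - p \<in> gen_ideal G}"

definition sigless :: "('n, 'k::field) sigpoly \<Rightarrow> ('n, 'k) sigpoly \<Rightarrow> bool"  (infix "<\<^sub>H" 50) where
  "h1 <\<^sub>H h2 \<longleftrightarrow> mult0 (HM (snd h1)) (fst h2) \<prec>\<^sub>0 mult0 (HM (snd h2)) (fst h1)"

text \<open>\<open>safe_reduction G f h1' h2 h1\<close>: the signature-safe reduction of \<open>h1'\<close> by \<open>h2\<close> is defined
  and equals \<open>h1\<close>. The polynomial \<open>K t\<close> is \<open>single t K\<close>.\<close>

definition safe_reduction ::
  "('n, 'k::field) mpoly set \<Rightarrow> ('n, 'k) mpoly
    \<Rightarrow> ('n, 'k) sigpoly \<Rightarrow> ('n, 'k) sigpoly \<Rightarrow> ('n, 'k) sigpoly \<Rightarrow> bool" where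
  "safe_reduction G f h1' h2 h1 \<longleftrightarrow>
    h1' \<in> labeled G f \<and> h2 \<in> labeled G f \<and>
    (\<exists>t K. fst (mon_times t h2) \<prec>\<^sub>0 fst h1' \<and>
      HM (snd h1') = HM (snd (mon_times t h2)) \<and> HM (snd h1') \<noteq> None \<and>
      h1 = (fst h1', snd h1' + Poly_Mapping.single t K * snd h2) \<and>
      HM (snd h1) \<prec>\<^sub>0 HM (snd h1'))"

definition reducers :: "('n, 'k::field) sigpoly set \<Rightarrow> ('n, 'k) sigpoly \<Rightarrow> ('n, 'k) sigpoly set" where
  "reducers R h = {r \<in> R. h <\<^sub>H r \<and> dvd0 (HM (snd r)) (HM (snd h))}"

text \<open>
  The elements added to \<open>B\<close> on account of the new element \<open>h\<close>. Matching the highest monomials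
  against \<open>Some\<close> makes both sets empty if \<open>snd h = 0\<close> and skips the \<open>r\<close> with \<open>snd r = 0\<close> in the
  first one; in the second one \<open>h <\<^sub>H r\<close> already excludes the latter.
\<close>

definition new_multiples ::
  "('n, 'k::field) sigpoly set \<Rightarrow> ('n, 'k) sigpoly \<Rightarrow> ('n, 'k) sigpoly set" where
  "new_multiples R h =
    {mon_times (lcm_mon s t - s) r | r s t.
      r \<in> R \<and> r <\<^sub>H h \<and> HM (snd r) = Some s \<and> HM (snd h) = Some t} \<union>
    {mon_times (lcm_mon s t - t) h | r s t.
      r \<in> R \<and> h <\<^sub>H r \<and> HM (snd r) = Some s \<and> HM (snd h) = Some t}"

definition prune ::
  "('n, 'k::field) sigpoly set \<Rightarrow> ('n, 'k) sigpoly set \<Rightarrow> ('n, 'k) sigpoly set" where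
  "prune R B = B - {b \<in> B. \<exists>r \<in> R. r <\<^sub>H b \<and> dvd0 (fst r) (fst b)}"

text \<open>
  \<open>reduce\<close> is one pass of the while loop of the reduction procedure. Once that loop has ended,
  \<open>continue\<close> and \<open>break\<close> perform the rest of the current iteration of the main loop. The
  selected element stays in \<open>B\<close>.
\<close>

inductive step ::
  "('n, 'k::field) mpoly set \<Rightarrow> ('n, 'k) mpoly \<Rightarrow> ('n, 'k) gb_config \<Rightarrow> ('n, 'k) gb_config \<Rightarrow> bool"
  for G f where
  reduce: "step G f (Reducing \<sigma> p R B) (Reducing \<sigma> q R B)"
    if "r \<in> reducers R (\<sigma>, p)"
      and "\<forall>r' \<in> reducers R (\<sigma>, p). \<not> r <\<^sub>H r'"
      and "safe_reduction G f (\<sigma>, p) r (\<sigma>, q)"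
| continue: "step G f (Reducing \<sigma> p R B) (Reducing \<sigma>' p' R' B')"
    if "reducers R (\<sigma>, p) = {}"
      and "R' = insert (\<sigma>, p) R"
      and "B' = prune R' (B \<union> new_multiples R' (\<sigma>, p))"
      and "(\<sigma>', p') \<in> B'"
      and "\<forall>b \<in> B'. \<not> fst b \<prec>\<^sub>0 \<sigma>'"
| break: "step G f (Reducing \<sigma> p R B) (Returned (snd ` R'))"
    if "reducers R (\<sigma>, p) = {}"
      and "R' = insert (\<sigma>, p) R"
      and "prune R' (B \<union> new_multiples R' (\<sigma>, p)) = {}"

definition initial :: "('n, 'k::field) mpoly set \<Rightarrow> ('n, 'k) mpoly \<Rightarrow> ('n, 'k) gb_config" where
  "initial G f =
    Reducing (Some 0) f ((\<lambda>g. (HM g, 0)) ` G \<union> (\<lambda>g. (None, g)) ` G) {}"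

text \<open>
  The algorithm is nondeterministic: termination means that no sequence of choices leads to an
  infinite run, and that a run cannot get stuck before the algorithm returns.
\<close>

definition terminates :: "('n, 'k::field) mpoly set \<Rightarrow> ('n, 'k) mpoly \<Rightarrow> bool" where
  "terminates G f \<longleftrightarrow>
    (\<nexists>c. c 0 = initial G f \<and> (\<forall>i::nat. step G f (c i) (c (Suc i)))) \<and>
    (\<forall>c. (step G f)\<^sup>*\<^sup>* (initial G f) c \<longrightarrow> (\<exists>S. c = Returned S) \<or> (\<exists>c'. step G f c c'))"

end

end

theory Submission
  imports Defs "HOL-Library.Infinite_Set"
begin

text \<open>
  Of the two parts of termination, the absence of infinite runs carries the idea. Write \<open>S(r)\<close>
  for the signature of \<open>r\<close>. Consider an iteration of the main loop that starts with a selected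
  \<open>(\<sigma>, p')\<close> and ends by adding \<open>(\<sigma>, p)\<close> to \<open>R\<close>, and let \<open>r \<in> R\<close> be an earlier element with
  \<open>S(r) | \<sigma>\<close>.

  \<^item> The selected pair has survived pruning, so \<open>r <\<^sub>H (\<sigma>, p')\<close> fails.
  \<^item> The selected pair admits a reduction: every element of \<open>B\<close> is built from two elements of \<open>R\<close>
    so that the \<open><\<^sub>H\<close>-larger one is a reducer for it (\<open>new_multiples_reducible\<close>). Hence
    \<open>HM p \<prec>\<^sub>0 HM p'\<close>, and the previous point sharpens to \<open>(\<sigma>, p) <\<^sub>H r\<close> (\<open>fresh_reduce\<close>).
  \<^item> Now \<open>r\<close> qualifies as a reducer for \<open>(\<sigma>, p)\<close> except possibly for divisibility. As \<open>(\<sigma>, p)\<close> is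
    irreducible, \<open>HM r\<close> does not divide \<open>HM p\<close> (\<open>fresh_irreducible\<close>).

  So the pairs \<open>(S(h), HM h)\<close> of the successively added \<open>h\<close> never contain an earlier pair that
  divides a later one in both components, and Dickson's lemma (\<open>dickson_pairs\<close>) allows only
  finitely many of them. The first iteration, whose \<open>(1, f)\<close> was not selected from \<open>B\<close>, is left out
  of this count. Within one iteration \<open>HM p\<close> decreases with each reduction, so the inner loop stops
  because \<open>\<prec>\<^sub>0\<close> is well-founded (\<open>no_infinite_run\<close>).

  A run cannot get stuck either (\<open>step_exists\<close>): \<open>R\<close> is finite and \<open><\<^sub>H\<close> is a strict partial order,
  so a maximal reducer exists whenever there is a reducer; reducing by it is signature-safe because
  \<open>(\<sigma>, p) <\<^sub>H r\<close> together with \<open>HM r | HM p\<close> says exactly that \<open>r\<close>, shifted to the highest monomial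
  of \<open>p\<close>, has a smaller signature than \<open>\<sigma>\<close>. Between two iterations, well-foundedness of \<open>\<prec>\<^sub>0\<close> gives
  an element of \<open>B\<close> with minimal signature unless \<open>B\<close> is empty. That all pairs involved are labeled polynomials, as a
  reduction step demands, is part of the invariant of runs.
\<close>

section \<open>Monomials and divisibility\<close>

text \<open>
  A nonincreasing subsequence of natural numbers is constant from the place on where it takes its
  minimum, so the monotone subsequence that any sequence has can be taken nondecreasing.
\<close>

lemma nat_sequence_monotone_subsequence:
  fixes s :: "nat \<Rightarrow> nat"
  shows "\<exists>\<phi>. strict_mono \<phi> \<and> incseq (\<lambda>k. s (\<phi> k))"
proof -
  obtain \<psi> where \<psi>: "strict_mono \<psi>" "monoseq (\<lambda>k. s (\<psi> k))"
    using seq_monosub by blast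
  show ?thesis
  proof (cases "incseq (\<lambda>k. s (\<psi> k))")
    case True
    with \<psi>(1) show ?thesis by blast
  next
    case False
    then have dec: "decseq (\<lambda>k. s (\<psi> k))"
      using \<psi>(2) by (simp add: monoseq_iff)
    define n where "n = arg_min (\<lambda>k. s (\<psi> k)) (\<lambda>_. True)"
    have least: "s (\<psi> n) \<le> s (\<psi> k)" for k
      unfolding n_def by (rule arg_min_nat_le) simp
    have const: "s (\<psi> (n + k)) = s (\<psi> n)" for k
      using least[of "n + k"] decseqD[OF dec, of n "n + k"] by simp
    have "strict_mono (\<lambda>k. \<psi> (n + k))"
      using \<psi>(1) by (auto simp: strict_mono_def)
    moreover have "incseq (\<lambda>k. s (\<psi> (n + k)))"
      by (simp add: const)
    ultimately show ?thesis by blast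
  qed
qed

text \<open>
  Passing to a further subsequence for one sequence after the other keeps what has been achieved.
  This is the combinatorial core of Dickson's lemma.
\<close>

lemma nat_sequences_monotone_subsequence:
  fixes F :: "(nat \<Rightarrow> nat) set"
  assumes "finite F"
  shows "\<exists>\<phi>. strict_mono \<phi> \<and> (\<forall>s\<in>F. incseq (\<lambda>k. s (\<phi> k)))"
  using assms
proof (induction F rule: finite_induct)
  case empty
  show ?case by (rule exI[of _ id]) (simp add: strict_mono_def)
next
  case (insert a F)
  then obtain \<phi> where \<phi>: "strict_mono \<phi>" "\<forall>s\<in>F. incseq (\<lambda>k. s (\<phi> k))" by blast
  obtain \<psi> where \<psi>: "strict_mono \<psi>" "incseq (\<lambda>k. a (\<phi> (\<psi> k)))"
    using nat_sequence_monotone_subsequence[of "\<lambda>k. a (\<phi> k)"] by blast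
  have "incseq (\<lambda>k. s (\<phi> (\<psi> k)))" if "s \<in> F" for s
    using \<phi>(2) that strict_mono_less_eq[OF \<psi>(1)] by (auto simp: mono_def)
  moreover have "strict_mono (\<lambda>k. \<phi> (\<psi> k))"
    using \<phi>(1) \<psi>(1) by (simp add: strict_mono_def)
  ultimately show ?case
    using \<psi>(2) by (intro exI[of _ "\<lambda>k. \<phi> (\<psi> k)"]) simp
qed

lemma mult0_eq_None: "mult0 s t = None \<longleftrightarrow> s = None \<or> t = None"
  by (cases s; cases t) auto

lemma mult0_commute: "mult0 s t = mult0 t s"
  by (cases s; cases t) (auto simp: add.commute)

lemma mult0_assoc: "mult0 (mult0 s t) u = mult0 s (mult0 t u)"
  by (cases s; cases t; cases u) (auto simp: add.assoc)

lemma mult0_left_commute: "mult0 s (mult0 t u) = mult0 t (mult0 s u)"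
  by (cases s; cases t; cases u) (auto simp: add.left_commute)

lemmas mult0_ac = mult0_assoc mult0_commute mult0_left_commute

lemma dvd0_None_iff: "dvd0 None t \<longleftrightarrow> t = None" "dvd0 s None \<longleftrightarrow> s = None"
  by (cases s) (auto simp: dvd0_def mult0_eq_None)

lemma dvd0_SomeI:
  fixes s t :: "'n mon"
  assumes "\<And>x. Poly_Mapping.lookup s x \<le> Poly_Mapping.lookup t x"
  shows "dvd0 (Some s) (Some t)"
proof -
  have "s + (t - s) = t"
    using assms by (intro poly_mapping_eqI) (simp add: lookup_add lookup_minus)
  then show ?thesis by (auto simp: dvd0_def intro!: exI[of _ "t - s"])
qed

lemma lcm_mon_minus_add:
  "lcm_mon s t - s + s = lcm_mon s t" "lcm_mon s t - t + t = lcm_mon s t"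
  by (rule poly_mapping_eqI; simp add: lookup_add lookup_minus lcm_mon.rep_eq)+

lemma dvd0_lcm_mon: "dvd0 (Some s) (Some (lcm_mon s t))" "dvd0 (Some t) (Some (lcm_mon s t))"
  by (rule dvd0_SomeI; simp add: lcm_mon.rep_eq)+

text \<open>
  Any constant would do as the value at \<open>None\<close>: comparing exponents is meaningful only between
  monomials, and the second hypothesis of \<open>dvd0I_exponents\<close> excludes the mixed case.
\<close>

definition exponent :: "'n \<Rightarrow> 'n mon0 \<Rightarrow> nat" where
  "exponent x t = (case t of None \<Rightarrow> 0 | Some s \<Rightarrow> Poly_Mapping.lookup s x)"

lemma dvd0I_exponents:
  assumes "\<And>x. exponent x s \<le> exponent x t" and "s = None \<longleftrightarrow> t = None"
  shows "dvd0 s t"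
  using assms by (cases s; cases t) (auto simp: exponent_def dvd0_None_iff intro: dvd0_SomeI)

text \<open>
  Dickson's lemma for pairs. On \<open>'n mon0\<close> divisibility is the product order of the exponents, with
  \<open>None\<close> as an extra component that is incomparable to all monomials. Such a disjoint sum becomes a
  product of copies of \<open>nat\<close> by adding the indicators of \<open>None\<close> and of its complement as two
  further coordinates: both can be nondecreasing only if they are constant.
\<close>

lemma dickson_pairs:
  fixes s t :: "nat \<Rightarrow> 'n::finite mon0"
  shows "\<exists>i j. i < j \<and> dvd0 (s i) (s j) \<and> dvd0 (t i) (t j)"
proof -
  define coords where "coords u =
      insert (\<lambda>k. of_bool (u k = None)) (insert (\<lambda>k. of_bool (u k \<noteq> None))
        ((\<lambda>x k. exponent x (u k)) ` UNIV))" for u :: "nat \<Rightarrow> 'n mon0"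
  have "finite (coords s \<union> coords t)" by (simp add: coords_def)
  then obtain \<phi> where \<phi>: "strict_mono \<phi>" "\<forall>a\<in>coords s \<union> coords t. incseq (\<lambda>k. a (\<phi> k))"
    using nat_sequences_monotone_subsequence by blast
  have "dvd0 (u (\<phi> 0)) (u (\<phi> 1))" if "coords u \<subseteq> coords s \<union> coords t" for u
  proof (rule dvd0I_exponents)
    have le: "a (\<phi> 0) \<le> a (\<phi> 1)" if "a \<in> coords u" for a
      using \<phi>(2) that \<open>coords u \<subseteq> _\<close> by (meson incseqD subsetD zero_le)
    show "exponent x (u (\<phi> 0)) \<le> exponent x (u (\<phi> 1))" for x
      using le[of "\<lambda>k. exponent x (u k)"] by (simp add: coords_def)
    show "u (\<phi> 0) = None \<longleftrightarrow> u (\<phi> 1) = None"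
      using le[of "\<lambda>k. of_bool (u k = None)"] le[of "\<lambda>k. of_bool (u k \<noteq> None)"]
      by (auto simp: coords_def split: if_splits)
  qed
  moreover have "\<phi> 0 < \<phi> 1" using \<phi>(1) by (simp add: strict_mono_def)
  ultimately show ?thesis by blast
qed

section \<open>Ideals and multiplication by a term\<close>

lemma gen_ideal_0: "0 \<in> gen_ideal A"
  and gen_ideal_base: "a \<in> A \<Longrightarrow> a \<in> gen_ideal A"
  and gen_ideal_add: "a \<in> gen_ideal A \<Longrightarrow> b \<in> gen_ideal A \<Longrightarrow> a + b \<in> gen_ideal A"
  and gen_ideal_mult: "b \<in> gen_ideal A \<Longrightarrow> c * b \<in> gen_ideal A"
proof -
  interpret module "(*) :: 'a \<Rightarrow> 'a \<Rightarrow> 'a" by (rule module_mult)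
  show "0 \<in> gen_ideal A"
    and "a \<in> A \<Longrightarrow> a \<in> gen_ideal A"
    and "a \<in> gen_ideal A \<Longrightarrow> b \<in> gen_ideal A \<Longrightarrow> a + b \<in> gen_ideal A"
    and "b \<in> gen_ideal A \<Longrightarrow> c * b \<in> gen_ideal A"
    unfolding gen_ideal_def by (fact span_zero span_base span_add span_scale)+
qed

lemma lookup_single_times:
  fixes p :: "('n, 'k::field) mpoly"
  shows "Poly_Mapping.lookup (Poly_Mapping.single t c * p) (t + s) = c * Poly_Mapping.lookup p s"
  by (simp add: lookup_mult lookup_single when_mult)

lemma keys_single_times:
  fixes p :: "('n, 'k::field) mpoly"
  assumes "c \<noteq> 0"
  shows "Poly_Mapping.keys (Poly_Mapping.single t c * p) = (+) t ` Poly_Mapping.keys p"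
proof
  show "Poly_Mapping.keys (Poly_Mapping.single t c * p) \<subseteq> (+) t ` Poly_Mapping.keys p"
    using keys_mult[of "Poly_Mapping.single t c" p] assms by auto
  show "(+) t ` Poly_Mapping.keys p \<subseteq> Poly_Mapping.keys (Poly_Mapping.single t c * p)"
    using assms by (auto simp: in_keys_iff lookup_single_times)
qed

section \<open>Highest monomials\<close>

context monomial_order
begin

lemma less_irrefl: "\<not> s \<prec> s"
  using well_founded by (metis irreflpD wfp_imp_irreflp)

lemma less_trans: "s \<prec> t \<Longrightarrow> t \<prec> u \<Longrightarrow> s \<prec> u"
  using transitive by (rule transpD)

lemma less_asym: "s \<prec> t \<Longrightarrow> \<not> t \<prec> s"
  using less_irrefl less_trans by blast

lemma less_linear: "s \<prec> t \<or> s = t \<or> t \<prec> s"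
  using linear totalpD[of "(\<prec>)" s t] by blast

lemma less_add_cancel: "u + s \<prec> u + t \<longleftrightarrow> s \<prec> t"
  by (metis compatible less_irrefl less_linear less_trans)

lemma less0_None [simp]: "\<not> s \<prec>\<^sub>0 None" and None_less0: "None \<prec>\<^sub>0 s \<longleftrightarrow> s \<noteq> None"
  by (cases s; simp)+

lemma less0_irrefl: "\<not> s \<prec>\<^sub>0 s"
  by (cases s) (auto simp: less_irrefl)

lemma less0_trans: "s \<prec>\<^sub>0 t \<Longrightarrow> t \<prec>\<^sub>0 u \<Longrightarrow> s \<prec>\<^sub>0 u"
  by (cases s; cases t; cases u) (auto intro: less_trans)

lemma less0_linear: "s \<prec>\<^sub>0 t \<or> s = t \<or> t \<prec>\<^sub>0 s"
  by (cases s; cases t) (auto simp: less_linear)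

lemma less0_mult: "mult0 (Some u) s \<prec>\<^sub>0 mult0 (Some u) t \<longleftrightarrow> s \<prec>\<^sub>0 t"
  by (cases s; cases t) (auto simp: less_add_cancel)

lemma wfp_less0: "wfp (\<prec>\<^sub>0)"
  unfolding wfp_iff_ex_minimal
proof (intro allI impI)
  fix Q :: "'n mon0 set" assume "Q \<noteq> {}"
  then obtain x where "x \<in> Q" by blast
  show "\<exists>z\<in>Q. \<forall>y. y \<prec>\<^sub>0 z \<longrightarrow> y \<notin> Q"
  proof (cases "None \<in> Q")
    case True
    then show ?thesis by (intro bexI[of _ None]) simp_all
  next
    case False
    with \<open>x \<in> Q\<close> have "{s. Some s \<in> Q} \<noteq> {}" by (cases x) auto
    then obtain z where "Some z \<in> Q" "\<forall>y. y \<prec> z \<longrightarrow> Some y \<notin> Q"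
      using well_founded unfolding wfp_iff_ex_minimal by (metis empty_iff mem_Collect_eq)
    then have "\<forall>y. y \<prec>\<^sub>0 Some z \<longrightarrow> y \<notin> Q"
      using False by (metis less0.simps(2) not_None_eq)
    with \<open>Some z \<in> Q\<close> show ?thesis by blast
  qed
qed

lemma HM_eq_None: "HM p = None \<longleftrightarrow> p = 0"
  by (simp add: HM_def)

lemma HM_eq_SomeI:
  assumes "t \<in> Poly_Mapping.keys p" and "\<And>s. s \<in> Poly_Mapping.keys p \<Longrightarrow> s \<noteq> t \<Longrightarrow> s \<prec> t"
  shows "HM p = Some t"
proof -
  have "(THE t. t \<in> Poly_Mapping.keys p \<and> (\<forall>s \<in> Poly_Mapping.keys p. s \<noteq> t \<longrightarrow> s \<prec> t)) = t"
    using assms less_asym by (intro the_equality) metis+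
  with assms(1) show ?thesis by (auto simp: HM_def)
qed

lemma HM_SomeD:
  assumes "HM p = Some t"
  shows "t \<in> Poly_Mapping.keys p" and "s \<in> Poly_Mapping.keys p \<Longrightarrow> s \<noteq> t \<Longrightarrow> s \<prec> t"
proof -
  have "p \<noteq> 0" using assms HM_eq_None[of p] by auto
  then have ne: "Poly_Mapping.keys p \<noteq> {}"
    by (metis (full_types) ex_in_conv in_keys_iff lookup_zero poly_mapping_eqI)
  obtain m where m: "m \<in> Poly_Mapping.keys p" "\<forall>s\<in>Poly_Mapping.keys p. s \<noteq> m \<longrightarrow> \<not> m \<prec> s"
    using Finite_Set.bex_max_element[of "Poly_Mapping.keys p" "(\<prec>)"] ne
    by (metis asymp_onI finite_keys less_irrefl less_trans transp_onI)
  then have "HM p = Some m" using less_linear by (intro HM_eq_SomeI) blast+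
  with assms m show "t \<in> Poly_Mapping.keys p" "s \<in> Poly_Mapping.keys p \<Longrightarrow> s \<noteq> t \<Longrightarrow> s \<prec> t"
    using less_linear by auto
qed

lemma HM_one: "HM 1 = Some 0"
  by (rule HM_eq_SomeI) auto

lemma HM_single_times:
  fixes p :: "('n, 'k::field) mpoly"
  assumes "c \<noteq> 0"
  shows "HM (Poly_Mapping.single t c * p) = mult0 (Some t) (HM p)"
proof (cases "HM p")
  case None
  then show ?thesis using HM_eq_None[of p] HM_eq_None[of "0 :: ('n, 'k) mpoly"] by simp
next
  case (Some s)
  have "HM (Poly_Mapping.single t c * p) = Some (t + s)"
    by (rule HM_eq_SomeI) (use HM_SomeD[OF Some] assms in \<open>auto simp: keys_single_times compatible\<close>)
  with Some show ?thesis by simp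
qed

lemma lookup_eq_0_above_HM:
  assumes "HM p \<prec>\<^sub>0 Some s"
  shows "Poly_Mapping.lookup p s = 0"
proof (cases "HM p")
  case None
  then show ?thesis by (simp add: HM_eq_None)
next
  case (Some t)
  with assms have "t \<prec> s" by simp
  then have "s \<notin> Poly_Mapping.keys p"
    using HM_SomeD(2)[OF Some, of s] less_asym[of t s] less_irrefl[of s] by metis
  then show ?thesis by (simp add: in_keys_iff)
qed

lemma HM_less0I:
  assumes "\<And>s. s \<in> Poly_Mapping.keys p \<Longrightarrow> s \<prec> t"
  shows "HM p \<prec>\<^sub>0 Some t"
  using assms HM_SomeD(1)[of p] by (cases "HM p") auto

lemma HM_add_lower:
  assumes "HM q \<prec>\<^sub>0 HM p"
  shows "HM (p + q) = HM p"
proof (cases "HM p")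
  case None
  with assms show ?thesis by simp
next
  case (Some t)
  show ?thesis unfolding Some
  proof (rule HM_eq_SomeI)
    show "t \<in> Poly_Mapping.keys (p + q)"
      using HM_SomeD(1)[OF Some] lookup_eq_0_above_HM[of q t] assms Some
      by (simp add: in_keys_iff lookup_add)
    fix s assume s: "s \<in> Poly_Mapping.keys (p + q)" "s \<noteq> t"
    then consider "s \<in> Poly_Mapping.keys p" | "s \<in> Poly_Mapping.keys q"
      using keys_add[of p q] by blast
    then show "s \<prec> t"
    proof cases
      case 1
      with s(2) show ?thesis using HM_SomeD(2)[OF Some] by blast
    next
      case 2
      then show ?thesis
        using lookup_eq_0_above_HM[of q s] assms Some less_linear[of s t] s(2) less0_trans[of "HM q" "Some t" "Some s"]
        by (auto simp: in_keys_iff)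
    qed
  qed
qed

text \<open>The constant \<open>K\<close> of a reduction step is minus the quotient of the highest coefficients.\<close>

lemma cancel_highest_term:
  assumes "HM p = Some t" and "HM q = Some t"
  obtains K where "HM (p + Poly_Mapping.single 0 K * q) \<prec>\<^sub>0 Some t"
proof
  let ?K = "- (Poly_Mapping.lookup p t / Poly_Mapping.lookup q t)"
  let ?r = "p + Poly_Mapping.single 0 ?K * q"
  have lookup_r: "Poly_Mapping.lookup ?r s
      = Poly_Mapping.lookup p s + ?K * Poly_Mapping.lookup q s" for s
    using lookup_single_times[of 0 ?K q s] by (simp add: lookup_add)
  show "HM ?r \<prec>\<^sub>0 Some t"
  proof (rule HM_less0I)
    fix s assume s: "s \<in> Poly_Mapping.keys ?r"
    have "s \<noteq> t"
    proof
      assume "s = t"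
      with s show False
        using HM_SomeD(1)[OF assms(2)] by (simp add: in_keys_iff lookup_r)
    qed
    moreover have "s \<in> Poly_Mapping.keys p \<or> s \<in> Poly_Mapping.keys q"
      using s by (auto simp: in_keys_iff lookup_r)
    ultimately show "s \<prec> t"
      using HM_SomeD(2)[OF assms(1)] HM_SomeD(2)[OF assms(2)] by blast
  qed
qed

section \<open>Labeled polynomials and signature-safe reduction\<close>

lemma labeledE:
  assumes "(\<sigma>, p) \<in> labeled G f"
  obtains u where "HM u = \<sigma>" and "u * f - p \<in> gen_ideal G"
  using assms by (auto simp: labeled_def)

lemma labeled_mon_times:
  fixes f :: "('n, 'k::field) mpoly"
  assumes "h \<in> labeled G f"
  shows "mon_times t h \<in> labeled G f"
proof -
  obtain \<sigma> p where h: "h = (\<sigma>, p)" by (cases h)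
  with assms obtain u where u: "HM u = \<sigma>" "u * f - p \<in> gen_ideal G"
    by (auto elim: labeledE)
  let ?T = "Poly_Mapping.single t (1::'k)"
  have "?T * u * f - ?T * p = ?T * (u * f - p)" by (simp add: algebra_simps)
  then have "?T * u * f - ?T * p \<in> gen_ideal G" using gen_ideal_mult[OF u(2)] by simp
  moreover have "HM (?T * u) = mult0 (Some t) \<sigma>" using u(1) by (simp add: HM_single_times)
  ultimately show ?thesis unfolding h labeled_def mon_times_def by auto
qed

lemma HM_mon_times: "HM (snd (mon_times t h)) = mult0 (Some t) (HM (snd h))"
  by (simp add: mon_times_def HM_single_times)

text \<open>
  If \<open>u\<close> and \<open>v\<close> witness that the two arguments are labeled, then \<open>u + K t v\<close> is a witness for the
  result: signature-safety says that \<open>t v\<close> has a lower highest monomial than \<open>u\<close>, so the signature is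
  kept.
\<close>

lemma labeled_safe_reduction:
  fixes f :: "('n, 'k::field) mpoly"
  assumes "safe_reduction G f h r h'"
  shows "h' \<in> labeled G f"
proof -
  obtain \<sigma> p \<tau> q where h: "h = (\<sigma>, p)" and r: "r = (\<tau>, q)" by (cases h; cases r)
  from assms obtain t K where
      tK: "mult0 (Some t) \<tau> \<prec>\<^sub>0 \<sigma>" "h' = (\<sigma>, p + Poly_Mapping.single t K * q)"
    and lab: "(\<sigma>, p) \<in> labeled G f" "(\<tau>, q) \<in> labeled G f"
    unfolding h r safe_reduction_def mon_times_def by auto
  obtain u where u: "HM u = \<sigma>" "u * f - p \<in> gen_ideal G" using lab(1) by (rule labeledE)
  obtain v where v: "HM v = \<tau>" "v * f - q \<in> gen_ideal G" using lab(2) by (rule labeledE)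
  let ?T = "Poly_Mapping.single t K"
  have "HM (?T * v) \<prec>\<^sub>0 HM u"
  proof (cases "K = 0")
    case True
    then have "HM (?T * v) = None" by (simp add: HM_eq_None)
    moreover have "HM u \<noteq> None" using tK(1) u(1) by (metis less0_None)
    ultimately show ?thesis by (simp add: None_less0)
  next
    case False
    with tK(1) u(1) v(1) show ?thesis by (simp add: HM_single_times)
  qed
  then have "HM (u + ?T * v) = \<sigma>" using u(1) HM_add_lower by blast
  moreover have "(u + ?T * v) * f - (p + ?T * q) = (u * f - p) + ?T * (v * f - q)"
    by (simp add: algebra_simps)
  then have "(u + ?T * v) * f - (p + ?T * q) \<in> gen_ideal G"
    using gen_ideal_add[OF u(2) gen_ideal_mult[OF v(2)]] by (simp only:)
  ultimately show ?thesis unfolding tK(2) labeled_def by blast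
qed

lemma sigless_irrefl: "\<not> h <\<^sub>H h"
  by (simp add: sigless_def less0_irrefl)

lemma sigless_None:
  assumes "h1 <\<^sub>H h2"
  shows "fst h1 \<noteq> None" and "HM (snd h2) \<noteq> None"
proof -
  have "mult0 (HM (snd h2)) (fst h1) \<noteq> None"
    using assms unfolding sigless_def by (metis less0_None)
  then show "fst h1 \<noteq> None" and "HM (snd h2) \<noteq> None"
    by (simp_all add: mult0_eq_None)
qed

text \<open>
  Think of \<open>h1 <\<^sub>H h2\<close> as comparing the fractions \<open>HM h / S(h)\<close>: the two hypotheses, multiplied by
  the missing signature each, are chained and the signature of \<open>h2\<close> is cancelled. If the
  signature of \<open>h3\<close> is \<open>None\<close>, its fraction is infinite and there is nothing to chain.
\<close>

lemma sigless_trans: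
  assumes "h1 <\<^sub>H h2" and "h2 <\<^sub>H h3"
  shows "h1 <\<^sub>H h3"
proof -
  obtain s1 where s1: "fst h1 = Some s1" using sigless_None(1)[OF assms(1)] by blast
  obtain s2 where s2: "fst h2 = Some s2" using sigless_None(1)[OF assms(2)] by blast
  have "mult0 (fst h3) (mult0 (HM (snd h1)) (fst h2)) \<prec>\<^sub>0 mult0 (fst h1) (mult0 (HM (snd h3)) (fst h2))"
  proof (cases "fst h3")
    case None
    then show ?thesis
      using s1 s2 sigless_None(2)[OF assms(2)] by (simp add: None_less0 mult0_eq_None)
  next
    case (Some s3)
    have "mult0 (fst h3) (mult0 (HM (snd h1)) (fst h2)) \<prec>\<^sub>0 mult0 (fst h3) (mult0 (HM (snd h2)) (fst h1))"
      using assms(1) unfolding Some less0_mult sigless_def .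
    moreover have "mult0 (fst h3) (mult0 (HM (snd h2)) (fst h1)) = mult0 (fst h1) (mult0 (HM (snd h2)) (fst h3))"
      by (simp only: mult0_ac)
    moreover have "mult0 (fst h1) (mult0 (HM (snd h2)) (fst h3)) \<prec>\<^sub>0 mult0 (fst h1) (mult0 (HM (snd h3)) (fst h2))"
      using assms(2) unfolding s1 less0_mult sigless_def .
    ultimately show ?thesis using less0_trans by simp
  qed
  moreover have "mult0 (fst h3) (mult0 (HM (snd h1)) (fst h2)) = mult0 (fst h2) (mult0 (HM (snd h1)) (fst h3))"
    and "mult0 (fst h1) (mult0 (HM (snd h3)) (fst h2)) = mult0 (fst h2) (mult0 (HM (snd h3)) (fst h1))"
    by (simp_all only: mult0_ac)
  ultimately have "mult0 (fst h2) (mult0 (HM (snd h1)) (fst h3)) \<prec>\<^sub>0 mult0 (fst h2) (mult0 (HM (snd h3)) (fst h1))"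
    by simp
  then show ?thesis unfolding s2 less0_mult sigless_def .
qed

text \<open>Multiplying \<open>r\<close> by a monomial does not change its fraction \<open>HM r / S(r)\<close>.\<close>

lemma mon_times_sigless: "mon_times u r <\<^sub>H h \<longleftrightarrow> r <\<^sub>H h"
  unfolding sigless_def HM_mon_times mult0_assoc
  by (simp add: mon_times_def mult0_left_commute[of "HM (snd h)"] less0_mult)

lemma reducers_mono: "R \<subseteq> R' \<Longrightarrow> reducers R h \<subseteq> reducers R' h"
  by (auto simp: reducers_def)

text \<open>
  The added multiple of the \<open><\<^sub>H\<close>-smaller partner has the least common multiple as its highest
  monomial, which the highest monomial of the larger partner divides; and being \<open><\<^sub>H\<close>-smaller is
  inherited by multiples. So the larger partner is a reducer.
\<close>

lemma new_multiples_reducible: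
  assumes "b \<in> new_multiples R h" and "h \<in> R"
  shows "reducers R b \<noteq> {}"
proof -
  from assms(1) consider
    (old) r s t where "b = mon_times (lcm_mon s t - s) r" "r <\<^sub>H h"
      "HM (snd r) = Some s" "HM (snd h) = Some t"
  | (new) r s t where "b = mon_times (lcm_mon s t - t) h" "r \<in> R" "h <\<^sub>H r"
      "HM (snd r) = Some s" "HM (snd h) = Some t"
    by (auto simp: new_multiples_def)
  then show ?thesis
  proof cases
    case old
    then have "h \<in> reducers R b"
      using assms(2) by (simp add: reducers_def mon_times_sigless HM_mon_times lcm_mon_minus_add dvd0_lcm_mon)
    then show ?thesis by blast
  next
    case new
    then have "r \<in> reducers R b"
      by (simp add: reducers_def mon_times_sigless HM_mon_times lcm_mon_minus_add dvd0_lcm_mon)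
    then show ?thesis by blast
  qed
qed

text \<open>
  With \<open>HM h = u HM r\<close>, the relation \<open>h <\<^sub>H r\<close> becomes \<open>u HM r S(r) \<prec>\<^sub>0 HM r S(h)\<close>; cancelling
  \<open>HM r\<close> leaves signature-safety of the reduction by \<open>u r\<close>.
\<close>

lemma safe_reduction_exists:
  fixes f :: "('n, 'k::field) mpoly"
  assumes "r \<in> reducers R h" and "h \<in> labeled G f" and "r \<in> labeled G f"
  shows "\<exists>q. safe_reduction G f h r (fst h, q)"
proof -
  have hr: "h <\<^sub>H r" and dvd: "dvd0 (HM (snd r)) (HM (snd h))"
    using assms(1) by (auto simp: reducers_def)
  obtain s where s: "HM (snd r) = Some s" using sigless_None(2)[OF hr] by blast
  obtain u where "mult0 (HM (snd r)) (Some u) = HM (snd h)" using dvd unfolding dvd0_def by blast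
  then have u: "HM (snd h) = Some (s + u)" by (simp add: s)
  let ?T = "Poly_Mapping.single u (1::'k)"
  have HM_T: "HM (?T * snd r) = Some (s + u)"
    using s by (simp add: HM_single_times add.commute)
  obtain K where K: "HM (snd h + Poly_Mapping.single 0 K * (?T * snd r)) \<prec>\<^sub>0 Some (s + u)"
    using u HM_T by (rule cancel_highest_term)
  have eq: "Poly_Mapping.single 0 K * (?T * snd r) = Poly_Mapping.single u K * snd r"
    by (simp add: mult.assoc[symmetric] mult_single)
  have "mult0 (Some s) (mult0 (Some u) (fst r)) \<prec>\<^sub>0 mult0 (Some s) (fst h)"
    using hr s u by (simp add: sigless_def flip: mult0_assoc)
  then have "fst (mon_times u r) \<prec>\<^sub>0 fst h" unfolding less0_mult mon_times_def by simp
  moreover have "HM (snd (mon_times u r)) = Some (s + u)"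
    using s by (simp add: HM_mon_times add.commute)
  ultimately have "safe_reduction G f h r (fst h, snd h + Poly_Mapping.single u K * snd r)"
    using assms(2,3) u K unfolding safe_reduction_def eq by auto
  then show ?thesis by blast
qed

section \<open>Runs of the algorithm\<close>

text \<open>
  Reducibility of the elements of \<open>B\<close> is what forces a selected element to be reduced at least once.
  The other parts serve progress: finiteness of \<open>R\<close> gives maximal reducers, and reduction steps
  are defined for labeled polynomials only.
\<close>

fun invariant :: "('n, 'k::field) mpoly set \<Rightarrow> ('n, 'k) mpoly \<Rightarrow> ('n, 'k) gb_config \<Rightarrow> bool" where
  "invariant G f (Reducing \<sigma> p R B) \<longleftrightarrow>
    finite R \<and> R \<subseteq> labeled G f \<and> B \<subseteq> labeled G f \<and> (\<sigma>, p) \<in> labeled G f \<and>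
    (\<forall>b \<in> B. reducers R b \<noteq> {})"
| "invariant G f (Returned S) \<longleftrightarrow> True"

lemma invariant_initial:
  fixes f :: "('n, 'k::field) mpoly"
  assumes "finite G"
  shows "invariant G f (initial G f)"
proof -
  have "(HM g, 0) \<in> labeled G f" if "g \<in> G" for g
  proof -
    have "g * f - 0 \<in> gen_ideal G"
      using gen_ideal_mult[OF gen_ideal_base[OF that], of f] by (simp add: mult.commute)
    then show ?thesis unfolding labeled_def by blast
  qed
  moreover have "(None, g) \<in> labeled G f" if "g \<in> G" for g
  proof -
    have "0 * f - g \<in> gen_ideal G" using gen_ideal_mult[OF gen_ideal_base[OF that], of "- 1"] by simp
    moreover have "HM (0 :: ('n, 'k) mpoly) = None" by (simp add: HM_eq_None)
    ultimately show ?thesis unfolding labeled_def by blast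
  qed
  moreover have "(Some 0, f) \<in> labeled G f"
    using HM_one gen_ideal_0[of G] by (auto simp: labeled_def intro!: exI[of _ 1])
  ultimately show ?thesis using assms by (auto simp: initial_def)
qed

lemma invariant_step:
  assumes "step G f c c'" and "invariant G f c"
  shows "invariant G f c'"
  using assms
proof (cases rule: step.cases)
  case (reduce r R \<sigma> p q B)
  then show ?thesis using assms(2) labeled_safe_reduction[of G f "(\<sigma>, p)" r "(\<sigma>, q)"] by simp
next
  case (continue R \<sigma> p R' B' B \<sigma>' p')
  have inv: "finite R" "R \<subseteq> labeled G f" "B \<subseteq> labeled G f" "(\<sigma>, p) \<in> labeled G f"
      "\<forall>b\<in>B. reducers R b \<noteq> {}"
    using assms(2) continue(1) by auto
  have "new_multiples R' (\<sigma>, p) \<subseteq> labeled G f"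
    using inv(2,4) unfolding new_multiples_def continue(4) by (blast intro: labeled_mon_times)
  then have "B' \<subseteq> labeled G f" using inv(3) by (auto simp: continue(5) prune_def)
  moreover have "reducers R' b \<noteq> {}" if "b \<in> B'" for b
  proof -
    have "b \<in> B \<or> b \<in> new_multiples R' (\<sigma>, p)" using that by (auto simp: continue(5) prune_def)
    then show ?thesis
      using inv(5) reducers_mono[of R R' b] new_multiples_reducible[of b R' "(\<sigma>, p)"]
      by (auto simp: continue(4))
  qed
  ultimately show ?thesis
    using inv continue(4,6) by (auto simp: continue(2))
qed simp

lemma step_exists:
  assumes "invariant G f (Reducing \<sigma> p R B)"
  shows "\<exists>c'. step G f (Reducing \<sigma> p R B) c'"
proof (cases "reducers R (\<sigma>, p) = {}")
  case True
  define R' where "R' = insert (\<sigma>, p) R"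
  define B' where "B' = prune R' (B \<union> new_multiples R' (\<sigma>, p))"
  show ?thesis
  proof (cases "B' = {}")
    case empty: True
    then show ?thesis using step.break[OF True R'_def] B'_def by blast
  next
    case False
    then have "fst ` B' \<noteq> {}" by simp
    then obtain \<sigma>' where "\<sigma>' \<in> fst ` B'" "\<forall>\<tau>. \<tau> \<prec>\<^sub>0 \<sigma>' \<longrightarrow> \<tau> \<notin> fst ` B'"
      using wfp_less0 unfolding wfp_iff_ex_minimal by meson
    then obtain p' where "(\<sigma>', p') \<in> B'" "\<forall>b \<in> B'. \<not> fst b \<prec>\<^sub>0 \<sigma>'" by force
    then show ?thesis using step.continue[OF True R'_def B'_def] by blast
  qed
next
  case False
  have "finite (reducers R (\<sigma>, p))" using assms by (simp add: reducers_def)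
  then obtain r where r: "r \<in> reducers R (\<sigma>, p)" "\<forall>r' \<in> reducers R (\<sigma>, p). r' \<noteq> r \<longrightarrow> \<not> r <\<^sub>H r'"
    using Finite_Set.bex_max_element[of "reducers R (\<sigma>, p)" "(<\<^sub>H)"] False
    by (metis asymp_onI sigless_irrefl sigless_trans transp_onI)
  then have "\<forall>r' \<in> reducers R (\<sigma>, p). \<not> r <\<^sub>H r'" using sigless_irrefl[of r] by metis
  moreover have "r \<in> labeled G f" "(\<sigma>, p) \<in> labeled G f"
    using r(1) assms by (auto simp: reducers_def)
  ultimately show ?thesis
    using safe_reduction_exists[OF r(1)] step.reduce[OF r(1)] by fastforce
qed

text \<open>
  The property of the current pair that holds throughout every iteration but the first. A freshly
  selected pair satisfies the second alternative for all \<open>r\<close>, by pruning; after one reduction the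
  first alternative holds for all \<open>r\<close>. Demanding a reducer in the
  second alternative lets it disappear by the end of the inner loop.
\<close>

definition fresh :: "('n, 'k::field) sigpoly set \<Rightarrow> 'n mon0 \<Rightarrow> ('n, 'k) mpoly \<Rightarrow> bool" where
  "fresh R \<sigma> p \<longleftrightarrow>
    (\<forall>r \<in> R. dvd0 (fst r) \<sigma> \<longrightarrow>
      (\<sigma>, p) <\<^sub>H r \<or> (\<not> r <\<^sub>H (\<sigma>, p) \<and> reducers R (\<sigma>, p) \<noteq> {}))"

lemma fresh_selected:
  assumes "(\<sigma>, p) \<in> prune R B" and "reducers R (\<sigma>, p) \<noteq> {}"
  shows "fresh R \<sigma> p"
  using assms by (auto simp: prune_def fresh_def)

text \<open>
  What is used of the old pair is only that \<open>r <\<^sub>H (\<sigma>, p)\<close> fails, i.e. that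
  \<open>HM p S(r)\<close> is at most \<open>HM r \<sigma>\<close>. Replacing \<open>HM p\<close> by the smaller \<open>HM q\<close> makes the inequality
  strict, because \<open>S(r)\<close> is not \<open>None\<close>: it divides \<open>\<sigma>\<close>, and a pair with signature \<open>None\<close> has no
  reducers.
\<close>

lemma fresh_reduce:
  assumes "fresh R \<sigma> p" and "reducers R (\<sigma>, p) \<noteq> {}" and "HM q \<prec>\<^sub>0 HM p"
  shows "fresh R \<sigma> q"
proof -
  have "\<sigma> \<noteq> None" using assms(2) sigless_None(1) by (fastforce simp: reducers_def)
  have "(\<sigma>, q) <\<^sub>H r" if r: "r \<in> R" "dvd0 (fst r) \<sigma>" for r
  proof -
    obtain s where s: "fst r = Some s" using r(2) \<open>\<sigma> \<noteq> None\<close> by (cases "fst r") (auto simp: dvd0_None_iff)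
    have "\<not> r <\<^sub>H (\<sigma>, p)"
      using assms(1) r sigless_trans sigless_irrefl unfolding fresh_def by blast
    then have "mult0 (HM p) (fst r) \<prec>\<^sub>0 mult0 (HM (snd r)) \<sigma> \<or> mult0 (HM p) (fst r) = mult0 (HM (snd r)) \<sigma>"
      using less0_linear by (auto simp: sigless_def)
    moreover have "mult0 (HM q) (fst r) \<prec>\<^sub>0 mult0 (HM p) (fst r)"
      using assms(3) by (simp add: s mult0_commute[of _ "Some s"] less0_mult)
    ultimately show ?thesis using less0_trans by (auto simp: sigless_def)
  qed
  then show ?thesis by (auto simp: fresh_def)
qed

lemma fresh_irreducible:
  assumes "fresh R \<sigma> p" and "reducers R (\<sigma>, p) = {}" and "r \<in> R" and "dvd0 (fst r) \<sigma>"
  shows "\<not> dvd0 (HM (snd r)) (HM p)"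
proof -
  have "(\<sigma>, p) <\<^sub>H r" using assms unfolding fresh_def by blast
  then show ?thesis using assms(2,3) by (cases r) (auto simp: reducers_def)
qed

text \<open>
  The times in \<open>main\<close> are those at which the inner loop has ended. There are infinitely many of them
  as \<open>HM p\<close> cannot decrease forever, and the pairs added at these times contradict Dickson's lemma.
\<close>

lemma no_infinite_run:
  fixes f :: "('n, 'k::field) mpoly"
  assumes "invariant G f (c 0)" and steps: "\<And>i::nat. step G f (c i) (c (Suc i))"
  shows False
proof -
  have inv: "invariant G f (c i)" for i
    by (induction i) (use assms invariant_step in blast)+
  have "\<exists>\<sigma> p R B. c i = Reducing \<sigma> p R B" for i
    using steps[of i] by (cases rule: step.cases) auto
  then obtain \<sigma> p R B where c: "\<And>i. c i = Reducing (\<sigma> i) (p i) (R i) (B i)" by metis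
  define main where "main = {i. reducers (R i) (\<sigma> i, p i) = {}}"
  have reduce: "\<sigma> (Suc i) = \<sigma> i \<and> R (Suc i) = R i \<and> HM (p (Suc i)) \<prec>\<^sub>0 HM (p i)"
    if "i \<notin> main" for i
    using steps[of i] that unfolding c main_def
    by (cases rule: step.cases) (auto simp: safe_reduction_def)
  have continue: "R (Suc i) = insert (\<sigma> i, p i) (R i) \<and> fresh (R (Suc i)) (\<sigma> (Suc i)) (p (Suc i))"
    if "i \<in> main" for i
    using steps[of i] unfolding c
  proof (cases rule: step.cases)
    case (reduce r)
    with that show ?thesis by (auto simp: main_def)
  next
    case continue
    have "(\<sigma> (Suc i), p (Suc i)) \<in> B (Suc i)" using continue by simp
    then have "reducers (R (Suc i)) (\<sigma> (Suc i), p (Suc i)) \<noteq> {}"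
      using inv[of "Suc i"] unfolding c by simp
    with continue show ?thesis by (auto intro: fresh_selected)
  qed
  have "R i \<subseteq> R (Suc i)" for i using reduce continue by (cases "i \<in> main") auto
  then have R_mono: "R i \<subseteq> R j" if "i \<le> j" for i j
    using that by (rule lift_Suc_mono_le)
  have "infinite main"
  proof
    assume "finite main"
    then obtain n where n: "\<forall>i\<in>main. i < n" using finite_nat_set_iff_bounded by blast
    define D where "D = range (\<lambda>k. HM (p (n + k)))"
    then have "D \<noteq> {}" by simp
    then obtain d where d: "d \<in> D" "\<forall>t. t \<prec>\<^sub>0 d \<longrightarrow> t \<notin> D"
      using wfp_less0 unfolding wfp_iff_ex_minimal by meson
    then obtain k where k: "d = HM (p (n + k))" by (auto simp: D_def)
    have "n + k \<notin> main" using n by (metis not_add_less1)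
    then have "HM (p (n + Suc k)) \<prec>\<^sub>0 d" using reduce[of "n + k"] by (simp add: k)
    moreover have "HM (p (n + Suc k)) \<in> D" unfolding D_def by (rule rangeI)
    ultimately show False using d(2) by blast
  qed
  \<comment> \<open>Nothing is known about the pair of the first iteration, so only what follows some time in
    \<open>main\<close> counts.\<close>
  then obtain n where "n \<in> main" by fastforce
  have fresh: "fresh (R i) (\<sigma> i) (p i)" if "Suc n \<le> i" for i
    using that
  proof (induction i rule: dec_induct)
    case base
    show ?case using continue \<open>n \<in> main\<close> by blast
  next
    case (step i)
    show ?case
    proof (cases "i \<in> main")
      case True
      then show ?thesis using continue by blast
    next
      case False
      then show ?thesis using fresh_reduce[OF step.IH] reduce[of i] by (simp add: main_def)
    qed
  qed
  have "infinite (main - {..n})" using \<open>infinite main\<close> by simp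
  then obtain \<phi> :: "nat \<Rightarrow> nat" where \<phi>: "strict_mono \<phi>" "\<And>k. \<phi> k \<in> main - {..n}"
    using infinite_enumerate[of "main - {..n}"] by blast
  obtain i j where ij: "i < j" "dvd0 (\<sigma> (\<phi> i)) (\<sigma> (\<phi> j))" "dvd0 (HM (p (\<phi> i))) (HM (p (\<phi> j)))"
    using dickson_pairs[of "\<lambda>k. \<sigma> (\<phi> k)" "\<lambda>k. HM (p (\<phi> k))"] by blast
  have "(\<sigma> (\<phi> i), p (\<phi> i)) \<in> R (Suc (\<phi> i))" using continue \<phi>(2) by blast
  moreover have "Suc (\<phi> i) \<le> \<phi> j" using \<phi>(1) ij(1) by (simp add: strict_mono_def Suc_leI)
  ultimately have "(\<sigma> (\<phi> i), p (\<phi> i)) \<in> R (\<phi> j)" using R_mono by blast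
  moreover have "fresh (R (\<phi> j)) (\<sigma> (\<phi> j)) (p (\<phi> j))" using \<phi>(2)[of j] by (intro fresh) auto
  moreover have "reducers (R (\<phi> j)) (\<sigma> (\<phi> j), p (\<phi> j)) = {}" using \<phi>(2)[of j] by (simp add: main_def)
  ultimately show False using fresh_irreducible ij(2,3) by fastforce
qed

end

theorem theorem13:
  fixes lt :: "'n::finite mon \<Rightarrow> 'n mon \<Rightarrow> bool"
    and G :: "('n, 'k::field) mpoly set"
    and f :: "('n, 'k) mpoly"
  assumes "monomial_order lt"
    and "finite G"
    and "monomial_order.groebner_basis lt G"
    and "\<forall>g \<in> G. g \<notin> constants"
    and "f \<noteq> 0"
  shows "monomial_order.terminates lt G f"
proof -
  interpret monomial_order lt by (rule assms(1))
  show ?thesis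
    unfolding terminates_def
  proof (intro conjI notI allI impI)
    assume "\<exists>c. c 0 = initial G f \<and> (\<forall>i::nat. step G f (c i) (c (Suc i)))"
    then show False using no_infinite_run invariant_initial[OF assms(2)] by metis
  next
    fix c assume "(step G f)\<^sup>*\<^sup>* (initial G f) c"
    then have "invariant G f c"
      by induction (use invariant_initial[OF assms(2)] invariant_step in blast)+
    then show "(\<exists>S. c = Returned S) \<or> (\<exists>c'. step G f c c')"
      using step_exists by (cases c) blast+
  qed
qed

end
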